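(* Let $M\ge1$ be an integer, $N=2M+1$, $R>0$ and $R_0=R$. Let $T_R$, $T_\theta$ and $K=K_2$ be the $N\times N$ matrices defined in the context (with $R_0=R$). Then their condition numbers in the 2-norm are $$\operatorname{cond}_2(T_R)=M,\qquad \operatorname{cond}_2(T_\theta)=\sqrt2,\qquad \operatorname{cond}_2(K_2)=\sqrt2\,M,$$ which are independent of $R$.
   Context: Put $\theta_j=2\pi(j-1)/N$ for $j=1,\dots,N$. In general, for $R,R_0>0$, the matrix $T_R\in\mathbb R^{(2M+1)\times(2M+1)}$ is diagonal with $$(T_R)_{1,1}=1,\qquad (T_R)_{2k,2k}=(T_R)_{2k+1,2k+1}=-\frac1k\left(\frac R{R_0}\right)^k\quad(k=1,\dots,M);$$ the matrix $T_\theta\in\mathbb R^{(2M+1)\times N}$ has entries $$(T_\theta)_{1,j}=1,\quad (T_\theta)_{2k,j}=\cos k\theta_j,\quad (T_\theta)_{2k+1,j}=\sin k\theta_j;$$ and the matrix $K\in\mathbb R^{(2M+1)\times N}$ has entries $$K_{1,j}=1,\quad K_{2k,j}=-\frac1k\left(\frac R{R_0}\right)^k\cos k\theta_j,\quad K_{2k+1,j}=-\frac1k\left(\frac R{R_0}\right)^k\sin k\theta_j$$ ($j=1,\dots,N$; $k=1,\dots,M$). $K_2$ denotes $K$ with $R_0=R$. For an invertible matrix $Q$, $\operatorname{cond}_2(Q)=\|Q\|_2\|Q^{-1}\|_2$, where $\|Q\|_2$ is the largest singular value of $Q$. *)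

theory Defs
  imports Complex_Main "Jordan_Normal_Form.Spectral_Radius"
    "Jordan_Normal_Form.Gauss_Jordan_Elimination"
begin

text \<open>
  Matrices of the Jordan normal form library are indexed from 0, whereas the formulas below number
  rows and columns from 1. The entry functions therefore take indices starting from 1, and the
  matrices apply them to the successors of the library indices. The rows \<open>i = 2k\<close> and
  \<open>i = 2k + 1\<close> are exactly those with \<open>i > 1\<close> and \<open>i div 2 = k\<close>, the even ones being the cosine
  rows.
\<close>

definition theta :: "nat \<Rightarrow> nat \<Rightarrow> real" where
  "theta N j = 2 * pi * (real j - 1) / real N"

definition T_R_diag :: "real \<Rightarrow> real \<Rightarrow> nat \<Rightarrow> real" where
  "T_R_diag R R0 i =
     (if i = 1 then 1 else - (1 / real (i div 2)) * (R / R0) ^ (i div 2))"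

definition T_R :: "nat \<Rightarrow> real \<Rightarrow> real \<Rightarrow> real mat" where
  "T_R M R R0 = mat_diag (2 * M + 1) (\<lambda>i. T_R_diag R R0 (Suc i))"

definition T_theta_entry :: "nat \<Rightarrow> nat \<Rightarrow> nat \<Rightarrow> real" where
  "T_theta_entry N i j =
     (if i = 1 then 1
      else if even i then cos (real (i div 2) * theta N j)
      else sin (real (i div 2) * theta N j))"

definition T_theta :: "nat \<Rightarrow> nat \<Rightarrow> real mat" where
  "T_theta M N = mat (2 * M + 1) N (\<lambda>(i, j). T_theta_entry N (Suc i) (Suc j))"

definition K_entry :: "nat \<Rightarrow> real \<Rightarrow> real \<Rightarrow> nat \<Rightarrow> nat \<Rightarrow> real" where
  "K_entry N R R0 i j =
     (if i = 1 then 1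
      else if even i
        then - (1 / real (i div 2)) * (R / R0) ^ (i div 2) * cos (real (i div 2) * theta N j)
      else - (1 / real (i div 2)) * (R / R0) ^ (i div 2) * sin (real (i div 2) * theta N j))"

definition K_mat :: "nat \<Rightarrow> nat \<Rightarrow> real \<Rightarrow> real \<Rightarrow> real mat" where
  "K_mat M N R R0 = mat (2 * M + 1) N (\<lambda>(i, j). K_entry N R R0 (Suc i) (Suc j))"

definition K2 :: "nat \<Rightarrow> nat \<Rightarrow> real \<Rightarrow> real mat" where
  "K2 M N R = K_mat M N R R"

definition singular_values :: "real mat \<Rightarrow> real set" where
  "singular_values Q = sqrt ` spectrum (transpose_mat Q * Q)"

definition norm2 :: "real mat \<Rightarrow> real" where
  "norm2 Q = Max (singular_values Q)"

text \<open>Meaningful for invertible \<open>Q\<close> only, since \<^const>\<open>mat_inverse\<close> is \<^const>\<open>None\<close> otherwise.\<close>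

definition cond2 :: "real mat \<Rightarrow> real" where
  "cond2 Q = norm2 Q * norm2 (the (mat_inverse Q))"

end

theory Submission
  imports Defs
begin

text \<open>
  The rows of \<open>T_\<theta>\<close> are orthogonal by discrete Fourier orthogonality, so for each of the three
  matrices \<open>Q Q\<^sup>T\<close> is an explicit diagonal matrix with positive entries. It is similar to
  \<open>Q\<^sup>T Q\<close>, and its inverse is \<open>Q\<^sup>-\<^sup>T Q\<^sup>-\<^sup>1\<close>; hence \<open>cond\<^sub>2 Q\<close> is the square root of
  the ratio of the largest to the smallest diagonal entry.
\<close>

section \<open>Condition numbers of matrices with orthogonal rows\<close>

lemma spectrum_mat_diag:
  "spectrum (mat_diag n d :: 'a :: field mat) = d ` {..<n}"
proof -
  have ut: "upper_triangular (mat_diag n d)"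
    by (auto simp: mat_diag_def)
  have "diag_mat (mat_diag n d) = map d [0..<n]"
    by (auto simp: diag_mat_def mat_diag_def)
  then have "char_poly (mat_diag n d) = (\<Prod>a\<leftarrow>map d [0..<n]. [:- a, 1:])"
    using char_poly_upper_triangular[OF mat_diag_dim ut] by simp
  then have "poly (char_poly (mat_diag n d)) k = 0 \<longleftrightarrow> k \<in> d ` {..<n}" for k
    by (auto simp: poly_prod_list prod_list_zero_iff)
  then show ?thesis
    by (auto simp: spectrum_root_char_poly[OF mat_diag_dim])
qed

lemma spectrum_similar_mat:
  assumes "A \<in> carrier_mat n n" "B \<in> carrier_mat n n" "similar_mat A (B :: 'a :: field mat)"
  shows "spectrum A = spectrum B"
  using assms by (simp add: spectrum_root_char_poly char_poly_similar[OF assms(3)])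

text \<open>Over a field, a one-sided inverse of a square matrix is two-sided and unique. This
  identifies the value of \<open>the (mat_inverse Q)\<close> in \<open>cond2\<close> with an
  explicit matrix.\<close>

lemma mat_inverse_SomeI:
  fixes A :: "'a :: field mat"
  assumes A: "A \<in> carrier_mat n n" and B: "B \<in> carrier_mat n n" and AB: "A * B = 1\<^sub>m n"
  shows "mat_inverse A = Some B"
proof (cases "mat_inverse A")
  case None
  have "B * A = 1\<^sub>m n"
    by (rule mat_mult_left_right_inverse[OF A B AB])
  then have "A \<in> Units (ring_mat TYPE('a) n ())"
    using A B AB unfolding Units_def ring_mat_def by auto
  with mat_inverse(1)[OF A None, of "()"] show ?thesis
    by blast
next
  case (Some C)
  from mat_inverse(2)[OF A Some] have C: "C * A = 1\<^sub>m n" "C \<in> carrier_mat n n"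
    by auto
  have "C = C * (A * B)"
    using AB C by simp
  also have "\<dots> = C * A * B"
    using assoc_mult_mat[OF C(2) A B] by simp
  also have "\<dots> = B"
    using B C by simp
  finally show ?thesis
    using Some by simp
qed

text \<open>The indices \<open>a\<close> and \<open>b\<close> of a smallest and a largest squared
  row norm are supplied as witnesses, so both maxima behind \<open>cond2\<close> have closed
  values.\<close>

lemma invertible_cond2_orthogonal_rows:
  fixes Q :: "real mat"
  assumes Q: "Q \<in> carrier_mat n n"
    and rows: "Q * transpose_mat Q = mat_diag n d"
    and pos: "\<And>i. i < n \<Longrightarrow> 0 < d i"
    and a: "a < n" "\<And>i. i < n \<Longrightarrow> d a \<le> d i"
    and b: "b < n" "\<And>i. i < n \<Longrightarrow> d i \<le> d b"
  shows "invertible_mat Q" and "cond2 Q = sqrt (d b / d a)"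
proof -
  define D :: "real mat" where "D = mat_diag n d"
  define E :: "real mat" where "E = mat_diag n (\<lambda>i. 1 / d i)"
  \<comment> \<open>Since \<open>Q * transpose_mat Q\<close> is \<open>D\<close> and
    \<open>E\<close> inverts \<open>D\<close>, this is a right inverse of \<open>Q\<close>.\<close>
  define B where "B = transpose_mat Q * E"
  have D: "D \<in> carrier_mat n n" and E: "E \<in> carrier_mat n n"
    by (auto simp: D_def E_def)
  have QT: "transpose_mat Q \<in> carrier_mat n n"
    using Q by simp
  then have B: "B \<in> carrier_mat n n"
    using E by (auto simp: B_def)
  have DE: "D * E = 1\<^sub>m n"
  proof -
    have "D * E = mat_diag n (\<lambda>i. d i * (1 / d i))"
      by (simp add: D_def E_def)
    also have "\<dots> = mat_diag n (\<lambda>i. 1)"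
      unfolding mat_diag_def using pos by (intro eq_matI) force+
    finally show ?thesis
      by simp
  qed
  have "Q * B = Q * transpose_mat Q * E"
    unfolding B_def using Q QT E by simp
  then have QB: "Q * B = 1\<^sub>m n"
    using rows DE by (simp add: D_def)
  have BQ: "B * Q = 1\<^sub>m n"
    by (rule mat_mult_left_right_inverse[OF Q B QB])
  show "invertible_mat Q"
    unfolding invertible_mat_def inverts_mat_def using Q B QB BQ by auto
  \<comment> \<open>\<open>norm2\<close> uses the product in the opposite order to
    \<open>rows\<close>; conjugation by \<open>Q\<close> carries one into the other.\<close>
  have "B * D * Q = B * (Q * transpose_mat Q) * Q"
    by (simp add: rows D_def)
  also have "\<dots> = (B * Q) * (transpose_mat Q * Q)"
    using Q QT B by (simp add: assoc_mult_mat[of _ n n _ n _ n])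
  also have "\<dots> = transpose_mat Q * Q"
    using Q QT BQ by simp
  finally have "similar_mat (transpose_mat Q * Q) D"
    using Q QT B D QB BQ by (intro similar_matI[of _ _ B Q n]) auto
  then have "spectrum (transpose_mat Q * Q) = spectrum D"
    using Q D by (intro spectrum_similar_mat[of _ n]) auto
  then have normQ: "norm2 Q = Max ((\<lambda>i. sqrt (d i)) ` {..<n})"
    by (simp add: norm2_def singular_values_def D_def spectrum_mat_diag image_image)
  have ET: "transpose_mat E = E"
    unfolding E_def mat_diag_def by (intro eq_matI) auto
  \<comment> \<open>For the inverse, the order of the factors is already right: the product
    collapses to \<open>E\<close> itself.\<close>
  have "transpose_mat B * B = E * (Q * B)"
    unfolding B_def using Q QT E ET
    by (simp add: transpose_mult[of _ n n _ n] assoc_mult_mat[of _ n n _ n _ n])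
  then have "transpose_mat B * B = E"
    using QB E by simp
  then have normB: "norm2 B = Max ((\<lambda>i. sqrt (1 / d i)) ` {..<n})"
    by (simp add: norm2_def singular_values_def E_def spectrum_mat_diag image_image)
  have "norm2 Q = sqrt (d b)"
    unfolding normQ using b by (intro Max_eqI) auto
  \<comment> \<open>Reciprocals reverse the order, so the smallest entry \<open>d a\<close> gives
    the largest singular value of \<open>B\<close>.\<close>
  moreover have "norm2 B = sqrt (1 / d a)"
    unfolding normB
  proof (intro Max_eqI)
    fix y assume "y \<in> (\<lambda>i. sqrt (1 / d i)) ` {..<n}"
    then obtain i where i: "i < n" "y = sqrt (1 / d i)"
      by auto
    then show "y \<le> sqrt (1 / d a)"
      using a pos[OF a(1)] by (auto intro!: divide_left_mono simp: pos)
  qed (use a in auto)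
  moreover have "mat_inverse Q = Some B"
    by (rule mat_inverse_SomeI[OF Q B QB])
  ultimately show "cond2 Q = sqrt (d b / d a)"
    by (simp add: cond2_def real_sqrt_divide)
qed

section \<open>Discrete Fourier orthogonality and Gram matrices\<close>

lemma sum_cis_roots_of_unity:
  fixes m :: int
  assumes "N > 0" and "\<not> int N dvd m"
  shows "(\<Sum>j<N. cis (of_int m * theta N (Suc j))) = 0"
proof -
  define z where "z = cis (2 * pi * of_int m / real N)"
  \<comment> \<open>The \<open>Suc\<close> cancels the shift in \<open>theta\<close>, so the sum is
    geometric in an \<open>N\<close>-th root of unity other than 1.\<close>
  have "cis (of_int m * theta N (Suc j)) = z ^ j" for j
    by (simp add: z_def DeMoivre theta_def mult_ac)
  moreover have "z ^ N = 1"
    using assms(1) by (simp add: z_def DeMoivre cis_multiple_2pi)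
  moreover have "z \<noteq> 1"
  proof
    assume "z = 1"
    then have "cos (2 * pi * of_int m / real N) = 1"
      by (simp add: z_def complex_eq_iff)
    then obtain k :: int where "2 * pi * of_int m / real N = of_int k * 2 * pi"
      using cos_one_2pi_int by auto
    then have "real_of_int m = of_int k * real N"
      using assms(1) by (simp add: field_simps)
    then have "m = k * int N"
      by (metis of_int_eq_iff of_int_mult of_int_of_nat_eq)
    with assms(2) show False
      by simp
  qed
  ultimately show ?thesis
    using geometric_sum[of z N] by simp
qed

lemma sum_cos_theta:
  fixes m :: int
  assumes "N > 0" and "\<bar>m\<bar> < int N"
  shows "(\<Sum>j<N. cos (of_int m * theta N (Suc j))) = (if m = 0 then real N else 0)"
proof (cases "m = 0")
  case False
  then have "\<not> int N dvd m"
    using assms(2) zdvd_imp_le[of "int N" "\<bar>m\<bar>"] by auto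
  from arg_cong[OF sum_cis_roots_of_unity[OF assms(1) this], of Re] False
  show ?thesis
    by simp
qed simp

lemma sum_sin_theta:
  fixes m :: int
  assumes "N > 0" and "\<bar>m\<bar> < int N"
  shows "(\<Sum>j<N. sin (of_int m * theta N (Suc j))) = 0"
proof (cases "m = 0")
  case False
  then have "\<not> int N dvd m"
    using assms(2) zdvd_imp_le[of "int N" "\<bar>m\<bar>"] by auto
  from arg_cong[OF sum_cis_roots_of_unity[OF assms(1) this], of Im]
  show ?thesis
    by simp
qed simp

text \<open>Product-to-sum formulas leave the frequencies \<open>k + l\<close> and
  \<open>k - l\<close>. The bound keeps both strictly between \<open>-N\<close> and
  \<open>N\<close>, where only frequency 0 survives; for \<open>k = l = 0\<close> both terms do,
  hence \<open>N\<close> instead of \<open>N / 2\<close>.\<close>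

lemma sum_trig_products:
  fixes k l :: nat
  assumes "k + l < N"
  defines "t \<equiv> \<lambda>j. theta N (Suc j)"
  shows "(\<Sum>j<N. cos (real k * t j) * cos (real l * t j))
           = (if k = l then if k = 0 then real N else real N / 2 else 0)"
    and "(\<Sum>j<N. sin (real k * t j) * sin (real l * t j))
           = (if k = l \<and> k \<noteq> 0 then real N / 2 else 0)"
    and "(\<Sum>j<N. sin (real k * t j) * cos (real l * t j)) = 0"
proof -
  have N: "N > 0"
    using assms by simp
  let ?p = "int k + int l" and ?m = "int k - int l"
  have p: "\<bar>?p\<bar> < int N" and m: "\<bar>?m\<bar> < int N"
    using assms by auto
  have args: "real k * x + real l * x = of_int ?p * x"
    "real k * x - real l * x = of_int ?m * x" for x
    by (simp_all add: algebra_simps)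
  note c = sum_cos_theta[OF N p] sum_cos_theta[OF N m]
  note s = sum_sin_theta[OF N p] sum_sin_theta[OF N m]
  show "(\<Sum>j<N. cos (real k * t j) * cos (real l * t j))
           = (if k = l then if k = 0 then real N else real N / 2 else 0)"
    unfolding cos_times_cos args t_def sum_divide_distrib[symmetric] sum.distrib c by auto
  show "(\<Sum>j<N. sin (real k * t j) * sin (real l * t j))
           = (if k = l \<and> k \<noteq> 0 then real N / 2 else 0)"
    unfolding sin_times_sin args t_def sum_divide_distrib[symmetric] sum_subtractf c by auto
  show "(\<Sum>j<N. sin (real k * t j) * cos (real l * t j)) = 0"
    unfolding sin_times_cos args t_def sum_divide_distrib[symmetric] sum.distrib s by simp
qed

text \<open>The constant row is the cosine row of frequency 0, so only two kinds of rows
  remain.\<close>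

lemma T_theta_entry_cases:
  assumes "i > 0"
  shows "T_theta_entry N i j =
    (if even i \<or> i = 1 then cos (real (i div 2) * theta N j) else sin (real (i div 2) * theta N j))"
  using assms by (auto simp: T_theta_entry_def)

lemma T_theta_rows_orthogonal:
  assumes "i < 2 * M + 1" "i' < 2 * M + 1" "N = 2 * M + 1"
  shows "(\<Sum>j<N. T_theta_entry N (Suc i) (Suc j) * T_theta_entry N (Suc i') (Suc j))
    = (if i = i' then if i = 0 then real N else real N / 2 else 0)"
proof -
  define k l where "k = Suc i div 2" and "l = Suc i' div 2"
  have "k \<le> M" "l \<le> M"
    using assms unfolding k_def l_def by auto
  \<comment> \<open>The choice \<open>N = 2 * M + 1\<close> enters here: frequencies up to
    \<open>M\<close> add up to at most \<open>2 * M\<close>, so there is no aliasing.\<close>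
  then have kl: "k + l < N" "l + k < N"
    using assms(3) by auto
  have k0: "k = 0 \<longleftrightarrow> i = 0" and l0: "l = 0 \<longleftrightarrow> i' = 0"
    unfolding k_def l_def by linarith+
  have eq: "i = i' \<longleftrightarrow> k = l \<and> (even i \<longleftrightarrow> even i')" if "i \<noteq> 0" "i' \<noteq> 0"
    using that unfolding k_def l_def by presburger
  \<comment> \<open>Counted from 0, the cosine rows of positive frequency are the odd ones.\<close>
  have rows: "T_theta_entry N (Suc i) (Suc j) =
      (if odd i \<or> i = 0 then cos (real k * theta N (Suc j)) else sin (real k * theta N (Suc j)))"
    "T_theta_entry N (Suc i') (Suc j) =
      (if odd i' \<or> i' = 0 then cos (real l * theta N (Suc j)) else sin (real l * theta N (Suc j)))"
    for j
    by (simp_all add: T_theta_entry_cases k_def l_def)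
  \<comment> \<open>The fourth fact, with frequencies exchanged, serves the case of a cosine row
    paired with a sine row.\<close>
  note sums = sum_trig_products[OF kl(1)] sum_trig_products(3)[OF kl(2)]
  show ?thesis
  proof (cases "odd i \<or> i = 0"; cases "odd i' \<or> i' = 0")
    assume "odd i \<or> i = 0" "odd i' \<or> i' = 0"
    then show ?thesis
      unfolding rows using sums(1) eq k0 l0 by auto
  next
    assume "odd i \<or> i = 0" "\<not> (odd i' \<or> i' = 0)"
    then show ?thesis
      unfolding rows using sums(4) by (auto simp: mult.commute)
  next
    assume "\<not> (odd i \<or> i = 0)" "odd i' \<or> i' = 0"
    then show ?thesis
      unfolding rows using sums(3) by auto
  next
    assume "\<not> (odd i \<or> i = 0)" "\<not> (odd i' \<or> i' = 0)"
    then show ?thesis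
      unfolding rows using sums(2) eq k0 l0 by auto
  qed
qed

text \<open>Scaling rows preserves their orthogonality. Weights 1 give \<open>T_theta\<close>, and
  the diagonal of \<open>T_R\<close> gives \<open>K2\<close>.\<close>

lemma scaled_T_theta_gram:
  assumes N: "N = 2 * M + 1"
    and Q: "Q = mat N N (\<lambda>(i, j). w i * T_theta_entry N (Suc i) (Suc j))"
  shows "Q * transpose_mat Q = mat_diag N (\<lambda>i. (w i)\<^sup>2 * (if i = 0 then real N else real N / 2))"
proof (rule eq_matI)
  fix i i'
  assume "i < dim_row (mat_diag N (\<lambda>i. (w i)\<^sup>2 * (if i = 0 then real N else real N / 2)))"
    and "i' < dim_col (mat_diag N (\<lambda>i. (w i)\<^sup>2 * (if i = 0 then real N else real N / 2)))"
  then have i: "i < N" "i' < N"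
    by (auto simp: mat_diag_def)
  have "(Q * transpose_mat Q) $$ (i, i') =
      (\<Sum>j<N. (w i * T_theta_entry N (Suc i) (Suc j)) * (w i' * T_theta_entry N (Suc i') (Suc j)))"
    using i by (simp add: Q scalar_prod_def atLeast0LessThan)
  also have "\<dots> = w i * w i' *
      (\<Sum>j<N. T_theta_entry N (Suc i) (Suc j) * T_theta_entry N (Suc i') (Suc j))"
    by (simp add: sum_distrib_left mult_ac)
  also have "\<dots> = w i * w i' * (if i = i' then if i = 0 then real N else real N / 2 else 0)"
    using T_theta_rows_orthogonal[of i M i' N] i N by simp
  finally show "(Q * transpose_mat Q) $$ (i, i') =
      mat_diag N (\<lambda>i. (w i)\<^sup>2 * (if i = 0 then real N else real N / 2)) $$ (i, i')"
    using i by (auto simp: mat_diag_def power2_eq_square)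
qed (auto simp: Q mat_diag_def)

text \<open>With equal radii the power of their ratio is 1, which is why the results do not depend
  on \<open>R\<close>.\<close>

lemma T_R_diag_square:
  assumes "R > 0"
  shows "(T_R_diag R R (Suc i))\<^sup>2 = (if i = 0 then 1 else 1 / (real (Suc i div 2))\<^sup>2)"
  using assms by (simp add: T_R_diag_def power_divide)

theorem proposition4:
  fixes M N :: nat and R R0 :: real
  assumes "M \<ge> 1" and "N = 2 * M + 1" and "R > 0" and "R0 = R"
  shows "invertible_mat (T_R M R R0) \<and> cond2 (T_R M R R0) = real M \<and>
         invertible_mat (T_theta M N) \<and> cond2 (T_theta M N) = sqrt 2 \<and>
         invertible_mat (K2 M N R) \<and> cond2 (K2 M N R) = sqrt 2 * real M"
proof -
  note sq = T_R_diag_square[OF \<open>R > 0\<close>]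
  define dR where "dR = (\<lambda>i. (T_R_diag R R (Suc i))\<^sup>2)"
  define dt where "dt = (\<lambda>i::nat. if i = 0 then real N else real N / 2)"
  have N: "N > 0" "2 * M < N"
    using assms by auto
  have half: "0 < Suc i div 2 \<and> Suc i div 2 \<le> M" if "i < N" "i \<noteq> 0" for i
    using that assms(2) by auto
  have dR_pos: "0 < dR i" if "i < N" for i
    using half[OF that] by (auto simp: dR_def sq)
  have dR_le: "dR i \<le> dR 0" if "i < N" for i
  proof (cases "i = 0")
    case False
    then have "1 \<le> (real (Suc i div 2))\<^sup>2"
      using half[OF that] by (intro one_le_power) linarith
    with False show ?thesis
      by (simp add: dR_def sq divide_le_eq)
  qed simp
  \<comment> \<open>Index \<open>2 * M\<close> is the last row, the sine row of the top frequency
    \<open>M\<close>, where the weight is smallest.\<close>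
  have dR_M: "dR (2 * M) = 1 / (real M)\<^sup>2"
    using assms(1) by (simp add: dR_def sq)
  have dR_ge: "dR (2 * M) \<le> dR i" if "i < N" for i
  proof (cases "i = 0")
    case True
    then show ?thesis
      using dR_le[OF N(2)] by simp
  next
    case False
    then have "(real (Suc i div 2))\<^sup>2 \<le> (real M)\<^sup>2" "0 < (real (Suc i div 2))\<^sup>2"
      using half[OF that] by (auto intro!: power_mono)
    with False show ?thesis
      unfolding dR_M by (simp add: dR_def sq frac_le)
  qed
  \<comment> \<open>Here \<open>M \<ge> 1\<close> matters: it makes the last row different from the
    constant row.\<close>
  have dt: "0 < dt i" "dt (2 * M) \<le> dt i" "dt i \<le> dt 0" for i
    using N assms(1) by (auto simp: dt_def)

  have R: "T_R M R R0 \<in> carrier_mat N N"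
    "T_R M R R0 * transpose_mat (T_R M R R0) = mat_diag N dR"
  proof -
    have "transpose_mat (T_R M R R0) = T_R M R R0"
      unfolding T_R_def mat_diag_def by (intro eq_matI) auto
    then show "T_R M R R0 * transpose_mat (T_R M R R0) = mat_diag N dR"
      using assms by (simp add: T_R_def dR_def power2_eq_square)
  qed (use assms in \<open>simp add: T_R_def\<close>)
  note condR = invertible_cond2_orthogonal_rows[OF R dR_pos N(2) dR_ge N(1) dR_le]

  have T: "T_theta M N \<in> carrier_mat N N"
    "T_theta M N * transpose_mat (T_theta M N) = mat_diag N dt"
    using scaled_T_theta_gram[of N M "T_theta M N" "\<lambda>_. 1"] assms
    by (auto simp: T_theta_def dt_def)
  note condT = invertible_cond2_orthogonal_rows[OF T dt(1) N(2) dt(2) N(1) dt(3)]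

  have entry: "K_entry N R R (Suc i) (Suc j)
      = T_R_diag R R (Suc i) * T_theta_entry N (Suc i) (Suc j)" for i j
    by (simp add: K_entry_def T_R_diag_def T_theta_entry_def)
  have K: "K2 M N R \<in> carrier_mat N N"
    "K2 M N R * transpose_mat (K2 M N R) = mat_diag N (\<lambda>i. dR i * dt i)"
  proof -
    have K: "K2 M N R =
        mat N N (\<lambda>(i, j). T_R_diag R R (Suc i) * T_theta_entry N (Suc i) (Suc j))"
      by (simp only: K2_def K_mat_def entry assms(2)[symmetric])
    then show "K2 M N R \<in> carrier_mat N N"
      by simp
    show "K2 M N R * transpose_mat (K2 M N R) = mat_diag N (\<lambda>i. dR i * dt i)"
      using scaled_T_theta_gram[OF assms(2) K] by (simp add: dR_def dt_def)
  qed
  have K_pos: "0 < dR i * dt i" if "i < N" for i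
    using dR_pos[OF that] dt(1) by simp
  \<comment> \<open>Both factors are smallest at \<open>2 * M\<close> and largest at 0, so the
    extremes of the product are products of extremes and the condition numbers multiply.\<close>
  have K_ge: "dR (2 * M) * dt (2 * M) \<le> dR i * dt i" if "i < N" for i
    using dR_ge[OF that] dR_pos[OF that] dt(1,2) by (intro mult_mono) (auto intro: less_imp_le)
  have K_le: "dR i * dt i \<le> dR 0 * dt 0" if "i < N" for i
    using dR_le[OF that] dR_pos[OF N(1)] dt(1,3) by (intro mult_mono) (auto intro: less_imp_le)
  note condK = invertible_cond2_orthogonal_rows[OF K K_pos N(2) K_ge N(1) K_le]

  have dR_0: "dR 0 = 1"
    by (simp add: dR_def sq)
  have dt_ratio: "dt 0 / dt (2 * M) = 2"
    using N assms(1) by (simp add: dt_def)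
  have "dR 0 * dt 0 / (dR (2 * M) * dt (2 * M)) = 2 * (real M)\<^sup>2"
    using N assms(1) by (simp add: dR_0 dR_M dt_def)
  then show ?thesis
    using condR condT condK by (simp add: dt_ratio dR_0 dR_M real_sqrt_mult)
qed

end
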